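(* Let $(L,\mu)$, with $\mu(x\otimes y)=xy$, be a commutative associative algebra over $K$ and $D:L\to L$ a derivation. Let $\alpha,\beta:L\to L$ be two commuting algebra maps such that any two of the maps $\alpha,\beta,D$ commute. Define, for all $x,y\in L$, $$[x,y]=\alpha(x)D(\beta(y))-\beta(y)D(\alpha(x)),\qquad x\cdot y=\alpha(x)\beta(y).$$ Then $(L,\cdot,[,],\alpha,\beta)$ is a transposed BiHom-Poisson algebra.
   Context: $K$ is a field of characteristic $0$; all vector spaces and linear maps are over $K$. A derivation $D$ of $L$ is a linear map with $D(xy)=D(x)y+xD(y)$. An algebra map is a linear map $\alpha$ with $\alpha(xy)=\alpha(x)\alpha(y)$; algebras are not assumed unital. A BiHom-commutative algebra $(L,\cdot,\alpha,\beta)$ is a vector space $L$ with a bilinear product $\cdot$ and linear maps $\alpha,\beta:L\to L$ such that for all $x,y,z$: $\alpha\circ\beta=\beta\circ\alpha$, $\alpha(x\cdot y)=\alpha(x)\cdot\alpha(y)$, $\beta(x\cdot y)=\beta(x)\cdot\beta(y)$, $\alpha(x)\cdot(y\cdot z)=(x\cdot y)\cdot\beta(z)$, and $\beta(x)\cdot\alpha(y)=\beta(y)\cdot\alpha(x)$. A BiHom-Lie algebra $(L,[,],\alpha,\beta)$ is a vector space $L$ with a bilinear bracket and commuting linear maps $\alpha,\beta:L\to L$ such that for all $x,y,z$: $\alpha([x,y])=[\alpha(x),\alpha(y)]$, $\beta([x,y])=[\beta(x),\beta(y)]$, $[\beta(x),\alpha(y)]=-[\beta(y),\alpha(x)]$,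 and $[[\beta(x),\alpha(y)],\alpha^2(z)]+[[\beta(y),\alpha(z)],\alpha^2(x)]+[[\beta(z),\alpha(x)],\alpha^2(y)]=0$. A transposed BiHom-Poisson algebra is a 5-tuple $(L,\cdot,[,],\alpha,\beta)$ such that $(L,\cdot,\alpha,\beta)$ is a BiHom-commutative algebra, $(L,[,],\alpha,\beta)$ is a BiHom-Lie algebra, and for all $x,y,z$: $2\alpha\beta(x)\cdot[y,z]=[\beta(x)\cdot y,\beta(z)]+[\beta(y),\alpha(x)\cdot z]$. *)

theory Defs
  imports Complex_Main
begin

text \<open>Vector spaces are the library's \<^locale>\<open>vector_space\<close>, with an explicit scalar multiplication by
  a field of characteristic 0. Products and brackets are explicit binary operations, since one
  space carries several of them; no product is assumed to be unital.\<close>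

locale bilinear_algebra = vector_space scale
  for scale :: "'k::field_char_0 \<Rightarrow> 'a::ab_group_add \<Rightarrow> 'a" +
  fixes mult :: "'a \<Rightarrow> 'a \<Rightarrow> 'a"
  assumes linear_right: "Vector_Spaces.linear scale scale (\<lambda>y. mult x y)"
    and linear_left: "Vector_Spaces.linear scale scale (\<lambda>x. mult x y)"

locale comm_assoc_algebra = bilinear_algebra scale mult
  for scale :: "'k::field_char_0 \<Rightarrow> 'a::ab_group_add \<Rightarrow> 'a"
    and mult :: "'a \<Rightarrow> 'a \<Rightarrow> 'a" +
  assumes mult_assoc: "mult (mult x y) z = mult x (mult y z)"
    and mult_commute: "mult x y = mult y x"

definition derivation ::
  "('k::field_char_0 \<Rightarrow> 'a::ab_group_add \<Rightarrow> 'a) \<Rightarrow> ('a \<Rightarrow> 'a \<Rightarrow> 'a) \<Rightarrow> ('a \<Rightarrow> 'a) \<Rightarrow> bool"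
  where "derivation scale mult D \<longleftrightarrow>
    Vector_Spaces.linear scale scale D \<and>
    (\<forall>x y. D (mult x y) = mult (D x) y + mult x (D y))"

definition algebra_map ::
  "('k::field_char_0 \<Rightarrow> 'a::ab_group_add \<Rightarrow> 'a) \<Rightarrow> ('a \<Rightarrow> 'a \<Rightarrow> 'a) \<Rightarrow> ('a \<Rightarrow> 'a) \<Rightarrow> bool"
  where "algebra_map scale mult \<alpha> \<longleftrightarrow>
    Vector_Spaces.linear scale scale \<alpha> \<and>
    (\<forall>x y. \<alpha> (mult x y) = mult (\<alpha> x) (\<alpha> y))"

locale bihom_commutative_algebra = bilinear_algebra scale dot
  for scale :: "'k::field_char_0 \<Rightarrow> 'a::ab_group_add \<Rightarrow> 'a"
    and dot :: "'a \<Rightarrow> 'a \<Rightarrow> 'a" +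
  fixes \<alpha> \<beta> :: "'a \<Rightarrow> 'a"
  assumes linear_alpha: "Vector_Spaces.linear scale scale \<alpha>"
    and linear_beta: "Vector_Spaces.linear scale scale \<beta>"
    and alpha_beta_commute: "\<alpha> \<circ> \<beta> = \<beta> \<circ> \<alpha>"
    and alpha_dot: "\<alpha> (dot x y) = dot (\<alpha> x) (\<alpha> y)"
    and beta_dot: "\<beta> (dot x y) = dot (\<beta> x) (\<beta> y)"
    and bihom_assoc: "dot (\<alpha> x) (dot y z) = dot (dot x y) (\<beta> z)"
    and bihom_commute: "dot (\<beta> x) (\<alpha> y) = dot (\<beta> y) (\<alpha> x)"

locale bihom_lie_algebra = bilinear_algebra scale bracket
  for scale :: "'k::field_char_0 \<Rightarrow> 'a::ab_group_add \<Rightarrow> 'a"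
    and bracket :: "'a \<Rightarrow> 'a \<Rightarrow> 'a" +
  fixes \<alpha> \<beta> :: "'a \<Rightarrow> 'a"
  assumes linear_alpha: "Vector_Spaces.linear scale scale \<alpha>"
    and linear_beta: "Vector_Spaces.linear scale scale \<beta>"
    and alpha_beta_commute: "\<alpha> \<circ> \<beta> = \<beta> \<circ> \<alpha>"
    and alpha_bracket: "\<alpha> (bracket x y) = bracket (\<alpha> x) (\<alpha> y)"
    and beta_bracket: "\<beta> (bracket x y) = bracket (\<beta> x) (\<beta> y)"
    and bihom_skew: "bracket (\<beta> x) (\<alpha> y) = - bracket (\<beta> y) (\<alpha> x)"
    and bihom_jacobi:
      "bracket (bracket (\<beta> x) (\<alpha> y)) (\<alpha> (\<alpha> z))
       + bracket (bracket (\<beta> y) (\<alpha> z)) (\<alpha> (\<alpha> x))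
       + bracket (bracket (\<beta> z) (\<alpha> x)) (\<alpha> (\<alpha> y)) = 0"

locale transposed_bihom_poisson_algebra =
  comm: bihom_commutative_algebra scale dot \<alpha> \<beta> + lie: bihom_lie_algebra scale bracket \<alpha> \<beta>
  for scale :: "'k::field_char_0 \<Rightarrow> 'a::ab_group_add \<Rightarrow> 'a"
    and dot bracket :: "'a \<Rightarrow> 'a \<Rightarrow> 'a"
    and \<alpha> \<beta> :: "'a \<Rightarrow> 'a" +
  assumes transposed_leibniz:
    "scale 2 (dot (\<alpha> (\<beta> x)) (bracket y z)) =
       bracket (dot (\<beta> x) y) (\<beta> z) + bracket (\<beta> y) (dot (\<alpha> x) z)"

end

theory Submission
  imports Defs
begin

text \<open>
  Write \<open>{a, b} = a D(b) - b D(a)\<close> for the Wronskian of \<open>a\<close> and \<open>b\<close>. The bracket and product of the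
  theorem are \<open>[x, y] = {\<alpha>(x), \<beta>(y)}\<close> and \<open>x \<cdot> y = \<alpha>(x) \<beta>(y)\<close>: both arise from an untwisted
  operation by applying \<open>\<alpha>\<close> to the first argument and \<open>\<beta>\<close> to the second. So the theorem splits
  into two independent facts.

  First, the Wronskian makes a commutative associative algebra with a derivation a transposed
  Poisson algebra, that is, a transposed BiHom-Poisson algebra whose structure maps are both the
  identity (\<open>transposed_poisson_wronskian\<close>). Its key identity is
  \<open>2 u {v, w} = {u v, w} + {v, u w}\<close>: expanding the right-hand side with the Leibniz rule, the two
  terms \<open>v w D(u)\<close> have opposite signs and cancel, while each of \<open>u v D(w)\<close> and \<open>- u w D(v)\<close> occurs
  twice.

  Second, twisting any transposed Poisson algebra by two commuting endomorphisms gives a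
  transposed BiHom-Poisson algebra (\<open>transposed_bihom_poisson_twist\<close>). The reason is that the
  BiHom identities carry exactly the powers of \<open>\<alpha>\<close> and \<open>\<beta>\<close> for which every term, once the twist is
  unfolded and the endomorphisms are pushed inside, has the same power of \<open>\<alpha>\<close> and \<open>\<beta>\<close> on each
  variable. Each identity is therefore an untwisted one evaluated at twisted arguments.

  Since \<open>\<alpha>\<close> and \<open>\<beta>\<close> commute with \<open>D\<close>, they preserve the Wronskian, and the second fact applies to
  the algebra of the first.
\<close>

lemmas linear_simps =
  module_hom.add[OF Vector_Spaces.linear.axioms(3)]
  module_hom.diff[OF Vector_Spaces.linear.axioms(3)]
  module_hom.scale[OF Vector_Spaces.linear.axioms(3)]

lemma bilinear_algebra_twist:
  assumes "bilinear_algebra scale m"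
    and \<alpha>: "Vector_Spaces.linear scale scale \<alpha>"
    and \<beta>: "Vector_Spaces.linear scale scale \<beta>"
  shows "bilinear_algebra scale (\<lambda>x y. m (\<alpha> x) (\<beta> y))"
proof -
  interpret bilinear_algebra scale m by fact
  show ?thesis
    by unfold_locales (simp_all add: linear_simps[OF \<alpha>] linear_simps[OF \<beta>]
        linear_simps[OF linear_left] linear_simps[OF linear_right])
qed

text \<open>
  The BiHom analogue of Yau's twisting principle; a transposed Poisson algebra is encoded as a
  transposed BiHom-Poisson algebra with identity structure maps.
\<close>

lemma transposed_bihom_poisson_twist:
  assumes "transposed_bihom_poisson_algebra scale m b id id"
    and \<alpha>m: "algebra_map scale m \<alpha>" and \<alpha>b: "algebra_map scale b \<alpha>"
    and \<beta>m: "algebra_map scale m \<beta>" and \<beta>b: "algebra_map scale b \<beta>"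
    and comm: "\<alpha> \<circ> \<beta> = \<beta> \<circ> \<alpha>"
  shows "transposed_bihom_poisson_algebra scale
    (\<lambda>x y. m (\<alpha> x) (\<beta> y)) (\<lambda>x y. b (\<alpha> x) (\<beta> y)) \<alpha> \<beta>"
proof -
  interpret P: transposed_bihom_poisson_algebra scale m b id id by fact
  have lin: "Vector_Spaces.linear scale scale \<alpha>" "Vector_Spaces.linear scale scale \<beta>"
    and hom: "\<And>x y. \<alpha> (m x y) = m (\<alpha> x) (\<alpha> y)" "\<And>x y. \<beta> (m x y) = m (\<beta> x) (\<beta> y)"
      "\<And>x y. \<alpha> (b x y) = b (\<alpha> x) (\<alpha> y)" "\<And>x y. \<beta> (b x y) = b (\<beta> x) (\<beta> y)"
    using \<alpha>m \<beta>m \<alpha>b \<beta>b by (auto simp: algebra_map_def)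
  \<comment> \<open>Oriented so that every composite is normalised to powers of \<open>\<alpha>\<close> applied after powers of \<open>\<beta>\<close>.\<close>
  have \<beta>\<alpha>: "\<beta> (\<alpha> x) = \<alpha> (\<beta> x)" for x
    using comm by (metis comp_apply)
  note push = hom \<beta>\<alpha>
  interpret M: bilinear_algebra scale "\<lambda>x y. m (\<alpha> x) (\<beta> y)"
    by (rule bilinear_algebra_twist[OF P.comm.bilinear_algebra_axioms lin])
  interpret B: bilinear_algebra scale "\<lambda>x y. b (\<alpha> x) (\<beta> y)"
    by (rule bilinear_algebra_twist[OF P.lie.bilinear_algebra_axioms lin])
  show ?thesis
  proof unfold_locales
    fix x y z
    show "m (\<alpha> (\<alpha> x)) (\<beta> (m (\<alpha> y) (\<beta> z))) = m (\<alpha> (m (\<alpha> x) (\<beta> y))) (\<beta> (\<beta> z))"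
      unfolding push by (rule P.comm.bihom_assoc[unfolded id_apply])
    show "m (\<alpha> (\<beta> x)) (\<beta> (\<alpha> y)) = m (\<alpha> (\<beta> y)) (\<beta> (\<alpha> x))"
      unfolding push by (rule P.comm.bihom_commute[unfolded id_apply])
    show "b (\<alpha> (\<beta> x)) (\<beta> (\<alpha> y)) = - b (\<alpha> (\<beta> y)) (\<beta> (\<alpha> x))"
      unfolding push by (rule P.lie.bihom_skew[unfolded id_apply])
    show "b (\<alpha> (b (\<alpha> (\<beta> x)) (\<beta> (\<alpha> y)))) (\<beta> (\<alpha> (\<alpha> z)))
        + b (\<alpha> (b (\<alpha> (\<beta> y)) (\<beta> (\<alpha> z)))) (\<beta> (\<alpha> (\<alpha> x)))
        + b (\<alpha> (b (\<alpha> (\<beta> z)) (\<beta> (\<alpha> x)))) (\<beta> (\<alpha> (\<alpha> y))) = 0"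
      unfolding push by (rule P.lie.bihom_jacobi[unfolded id_apply])
    show "scale 2 (m (\<alpha> (\<alpha> (\<beta> x))) (\<beta> (b (\<alpha> y) (\<beta> z)))) =
        b (\<alpha> (m (\<alpha> (\<beta> x)) (\<beta> y))) (\<beta> (\<beta> z)) + b (\<alpha> (\<beta> y)) (\<beta> (m (\<alpha> (\<alpha> x)) (\<beta> z)))"
      unfolding push by (rule P.transposed_leibniz[unfolded id_apply])
  qed (simp_all add: push comm linear_simps[OF lin(1)] linear_simps[OF lin(2)])
qed

lemma transposed_poisson_wronskian:
  assumes "comm_assoc_algebra scale \<mu>" and der: "derivation scale \<mu> D"
  shows "transposed_bihom_poisson_algebra scale \<mu> (\<lambda>x y. \<mu> x (D y) - \<mu> y (D x)) id id"
proof -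
  interpret comm_assoc_algebra scale \<mu> by fact
  have linD: "Vector_Spaces.linear scale scale D"
    and leibniz: "\<And>x y. D (\<mu> x y) = \<mu> (D x) y + \<mu> x (D y)"
    using der by (auto simp: derivation_def)
  note D_simps = linear_simps[OF linD] leibniz
  note mult_simps = linear_simps[OF linear_left] linear_simps[OF linear_right]
  have mult_left_commute: "\<mu> x (\<mu> y z) = \<mu> y (\<mu> x z)" for x y z
    by (metis mult_assoc mult_commute)
  note mult_ac = mult_assoc mult_commute mult_left_commute
  have scale_2: "scale 2 x = x + x" for x
    using scale_left_distrib[of 1 1 x] by simp
  show ?thesis
  proof unfold_locales
    fix x y z
    \<comment> \<open>Jacobi: \<open>D{x, y} = x D(D(y)) - y D(D(x))\<close>, since the two terms \<open>D(x) D(y)\<close> cancel. Hence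
      \<open>{{x, y}, z}\<close> is \<open>x D(y) D(z) - y D(x) D(z)\<close> minus \<open>x z D(D(y)) - y z D(D(x))\<close>, and each of
      these two differences vanishes in the cyclic sum.\<close>
    show "\<mu> (\<mu> (id x) (D (id y)) - \<mu> (id y) (D (id x))) (D (id (id z)))
          - \<mu> (id (id z)) (D (\<mu> (id x) (D (id y)) - \<mu> (id y) (D (id x))))
        + (\<mu> (\<mu> (id y) (D (id z)) - \<mu> (id z) (D (id y))) (D (id (id x)))
          - \<mu> (id (id x)) (D (\<mu> (id y) (D (id z)) - \<mu> (id z) (D (id y)))))
        + (\<mu> (\<mu> (id z) (D (id x)) - \<mu> (id x) (D (id z))) (D (id (id y)))
          - \<mu> (id (id y)) (D (\<mu> (id z) (D (id x)) - \<mu> (id x) (D (id z))))) = 0"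
      by (simp add: mult_simps D_simps mult_ac algebra_simps)
    show "scale 2 (\<mu> (id (id x)) (\<mu> y (D z) - \<mu> z (D y))) =
        \<mu> (\<mu> (id x) y) (D (id z)) - \<mu> (id z) (D (\<mu> (id x) y))
        + (\<mu> (id y) (D (\<mu> (id x) z)) - \<mu> (\<mu> (id x) z) (D (id y)))"
      by (simp add: scale_2 mult_simps D_simps mult_ac algebra_simps)
  qed (simp_all add: mult_simps D_simps mult_ac algebra_simps)
qed

lemma algebra_map_wronskian:
  assumes "algebra_map scale \<mu> f" and "f \<circ> D = D \<circ> f"
  shows "algebra_map scale (\<lambda>x y. \<mu> x (D y) - \<mu> y (D x)) f"
proof -
  have lin: "Vector_Spaces.linear scale scale f"
    using assms(1) by (simp add: algebra_map_def)
  have "f (x - y) = f x - f y" for x y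
    using lin by (rule linear_simps)
  moreover have "f (D x) = D (f x)" for x
    using assms(2) by (metis comp_apply)
  ultimately show ?thesis
    using assms(1) by (simp add: algebra_map_def)
qed

theorem proposition2p4:
  fixes scale :: "'k::field_char_0 \<Rightarrow> 'a::ab_group_add \<Rightarrow> 'a"
    and \<mu> :: "'a \<Rightarrow> 'a \<Rightarrow> 'a"
    and D \<alpha> \<beta> :: "'a \<Rightarrow> 'a"
  assumes "comm_assoc_algebra scale \<mu>"
    and "derivation scale \<mu> D"
    and "algebra_map scale \<mu> \<alpha>"
    and "algebra_map scale \<mu> \<beta>"
    and "\<alpha> \<circ> \<beta> = \<beta> \<circ> \<alpha>"
    and "\<alpha> \<circ> D = D \<circ> \<alpha>"
    and "\<beta> \<circ> D = D \<circ> \<beta>"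
  shows "transposed_bihom_poisson_algebra scale
    (\<lambda>x y. \<mu> (\<alpha> x) (\<beta> y))
    (\<lambda>x y. \<mu> (\<alpha> x) (D (\<beta> y)) - \<mu> (\<beta> y) (D (\<alpha> x)))
    \<alpha> \<beta>"
  by (rule transposed_bihom_poisson_twist[OF transposed_poisson_wronskian[OF assms(1,2)]
        assms(3) algebra_map_wronskian[OF assms(3,6)]
        assms(4) algebra_map_wronskian[OF assms(4,7)] assms(5)])

end
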